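(* Let $p$ be an odd prime and $m\geq 1$ be an integer. Then $$(q^{mp+1};q)_{p-1}-q^{mp(p-1)/2}(q;q)_{p-1}\equiv\frac{m(m+1)(p^2-1)p}{24}(1-q)^2[p]_q^2 \pmod{[p]_q^3}.$$
   Context: Here $q$ is an indeterminate. The $q$-number is $[n]_q=\frac{1-q^n}{1-q}=1+q+\cdots+q^{n-1}$, and the $q$-shifted factorial is $(A;q)_n=(1-A)(1-Aq)\cdots(1-Aq^{n-1})$. For polynomials $A,B,C$ in $\mathbb{Q}[q]$, $A\equiv B \pmod{C}$ means that $C$ divides $A-B$ in $\mathbb{Q}[q]$ (for $A,B$ with integer coefficients this is the same as divisibility in $\mathbb{Z}[q]$ when $C$ is a power of the monic polynomial $[p]_q$). *)

theory Defs
  imports "HOL-Computational_Algebra.Computational_Algebra" "HOL-Number_Theory.Cong"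
begin

definition qnumber :: "'a::comm_ring_1 \<Rightarrow> nat \<Rightarrow> 'a" where
  "qnumber q n = (\<Sum>i<n. q ^ i)"

text \<open>The quotient form of the \<open>q\<close>-number, written without division.\<close>

lemma one_minus_mult_qnumber: "(1 - q) * qnumber q n = 1 - q ^ n"
  by (simp add: qnumber_def one_diff_power_eq)

definition qpochhammer :: "'a::comm_ring_1 \<Rightarrow> 'a \<Rightarrow> nat \<Rightarrow> 'a" where
  "qpochhammer A q n = (\<Prod>i<n. 1 - A * q ^ i)"

abbreviation indet :: "rat poly" where
  "indet \<equiv> [:0, 1:]"

text \<open>The library's congruence, given by equality of remainders, is on \<open>rat poly\<close>
  divisibility of the difference.\<close>

lemma cong_rat_poly_iff: "[A = B] (mod C) \<longleftrightarrow> C dvd A - B" for A B C :: "rat poly"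
  by (simp add: cong_def mod_eq_dvd_iff)

end

theory Submission
  imports Defs
begin

text \<open>
  Expand \<open>(z - x q) \<cdots> (z - x q\<^sup>p\<^sup>-\<^sup>1) = \<Sum>k<p. a\<^sub>k x\<^sup>k z\<^sup>p\<^sup>-\<^sup>1\<^sup>-\<^sup>k\<close> and put
  \<open>t = 1 - q\<^sup>p = (1 - q)[p]\<close>, \<open>h = (p - 1) / 2\<close>. With \<open>x = q\<^sup>m\<^sup>p\<close>, \<open>z = 1\<close> the left-hand side of the
  congruence becomes \<open>\<Sum>k. a\<^sub>k ((1 - t)\<^sup>m\<^sup>k - (1 - t)\<^sup>m\<^sup>h)\<close>. The substitution \<open>j \<mapsto> p - j\<close> in the product at
  \<open>x = 1\<close>, \<open>z = q\<^sup>p\<close> gives the exact relation \<open>\<Sum>k. a\<^sub>k ((1 - t)\<^sup>p\<^sup>-\<^sup>1\<^sup>-\<^sup>k - (1 - t)\<^sup>h) = 0\<close>, \<open>m\<close> times which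
  cancels the terms linear in \<open>t\<close>. What remains is \<open>t\<^sup>2\<close> times a combination of the \<open>a\<^sub>k\<close>, which
  need only be known modulo \<open>[p]\<close>, where \<open>a\<^sub>k \<equiv> 1\<close>.
\<close>

section \<open>Coefficients of the two-variable product\<close>

text \<open>Up to sign and a power of \<open>q\<close>, a Gaussian binomial coefficient.\<close>

fun rothe_coeff :: "'a::comm_ring_1 \<Rightarrow> nat \<Rightarrow> nat \<Rightarrow> 'a" where
  "rothe_coeff q n 0 = 1"
| "rothe_coeff q 0 (Suc k) = 0"
| "rothe_coeff q (Suc n) (Suc k) = rothe_coeff q n (Suc k) - q ^ Suc n * rothe_coeff q n k"

lemma rothe_coeff_eq_0: "n < k \<Longrightarrow> rothe_coeff q n k = 0"
  by (induction q n k rule: rothe_coeff.induct) auto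

lemma prod_eq_sum_rothe_coeff:
  fixes q x z :: "'a::comm_ring_1"
  shows "(\<Prod>i<n. z - x * q ^ Suc i) = (\<Sum>k\<le>n. rothe_coeff q n k * x ^ k * z ^ (n - k))"
proof (induction n)
  case 0
  then show ?case by simp
next
  case (Suc n)
  let ?a = "rothe_coeff q n"
  have "(\<Sum>k\<le>n. ?a k * x ^ k * z ^ (n - k)) * z = (\<Sum>k\<le>n. ?a k * x ^ k * z ^ (Suc n - k))"
    by (simp add: sum_distrib_left sum_distrib_right Suc_diff_le mult_ac)
  \<comment> \<open>The added term \<open>k = Suc n\<close> has coefficient 0; with it the index can
    be shifted to match the other sum.\<close>
  also have "\<dots> = (\<Sum>k\<le>Suc n. ?a k * x ^ k * z ^ (Suc n - k))"
    by (simp add: rothe_coeff_eq_0)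
  also have "\<dots> = z ^ Suc n + (\<Sum>k\<le>n. ?a (Suc k) * x ^ Suc k * z ^ (n - k))"
    by (subst sum.atMost_Suc_shift) simp
  finally have *: "(\<Sum>k\<le>n. ?a k * x ^ k * z ^ (n - k)) * z = \<dots>" .
  have "(\<Prod>i<Suc n. z - x * q ^ Suc i)
      = (\<Sum>k\<le>n. ?a k * x ^ k * z ^ (n - k)) * z
        - (\<Sum>k\<le>n. ?a k * x ^ k * z ^ (n - k)) * (x * q ^ Suc n)"
    by (simp only: prod.lessThan_Suc Suc.IH right_diff_distrib)
  also have "\<dots> = z ^ Suc n + (\<Sum>k\<le>n. (?a (Suc k) - q ^ Suc n * ?a k) * x ^ Suc k * z ^ (n - k))"
    unfolding * by (simp add: sum_distrib_left sum_distrib_right sum_subtractf algebra_simps)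
  also have "\<dots> = (\<Sum>k\<le>Suc n. rothe_coeff q (Suc n) k * x ^ k * z ^ (Suc n - k))"
    by (subst sum.atMost_Suc_shift) simp
  finally show ?case .
qed

text \<open>The ratio of neighbouring Gaussian binomials, free of division. For
  \<open>n = p - 1\<close> the two factors differ by \<open>1 - q ^ p\<close>, so neighbouring
  coefficients can be compared modulo \<open>qnumber q p\<close>.\<close>

lemma rothe_coeff_recurrence:
  fixes q :: "'a::comm_ring_1"
  shows "(1 - q ^ Suc k) * rothe_coeff q n (Suc k) = (q ^ Suc n - q ^ Suc k) * rothe_coeff q n k"
proof (induction n arbitrary: k)
  case 0
  then show ?case by (cases k) simp_all
next
  case (Suc n)
  show ?case
  proof (cases k)
    case 0
    with Suc.IH[of 0] show ?thesis by (simp add: algebra_simps)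
  next
    case (Suc j)
    have 1: "(1 - q ^ Suc k) * rothe_coeff q n (Suc k) = (q ^ Suc n - q ^ Suc k) * rothe_coeff q n k"
      and 2: "(1 - q ^ k) * rothe_coeff q n k = (q ^ Suc n - q ^ k) * rothe_coeff q n j"
      using Suc.IH[of k] Suc.IH[of j] Suc by auto
    have "(1 - q ^ Suc k) * rothe_coeff q (Suc n) (Suc k)
        = (q ^ Suc n - q ^ Suc k) * rothe_coeff q n k
          - q ^ Suc n * (1 - q ^ Suc k) * rothe_coeff q n k"
      unfolding 1[symmetric] by (simp add: algebra_simps)
    also have "\<dots> = q * ((q ^ Suc n - q ^ k) * rothe_coeff q n k
        - q ^ Suc n * ((1 - q ^ k) * rothe_coeff q n k))"
      by (simp add: algebra_simps)
    also have "\<dots> = (q ^ Suc (Suc n) - q ^ Suc k) * rothe_coeff q (Suc n) k"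
      unfolding 2 by (simp add: Suc algebra_simps)
    finally show ?thesis .
  qed
qed

section \<open>Cancellation modulo \<open>qnumber q p\<close>\<close>

lemma one_minus_dvd_one_minus_power: "1 - x dvd 1 - x ^ n" for x :: "'a::comm_ring_1"
  using one_diff_power_eq[of x n] by simp

lemma qnumber_dvd_one_minus_power: "qnumber q n dvd 1 - q ^ (n * k)"
proof -
  have "qnumber q n dvd 1 - q ^ n"
    using one_minus_mult_qnumber[of q n] by (metis dvd_triv_right)
  also have "\<dots> dvd 1 - (q ^ n) ^ k"
    by (rule one_minus_dvd_one_minus_power)
  finally show ?thesis by (simp add: power_mult)
qed

lemma qnumber_dvd_cancel_one_minus:
  fixes q d :: "rat poly"
  assumes "n > 0" and dvd: "qnumber q n dvd (1 - q) * d"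
  shows "qnumber q n dvd d"
proof -
  \<comment> \<open>\<open>1 - q\<close> divides \<open>n - [n]\<close>, and \<open>n\<close> is a unit of \<open>rat poly\<close>.\<close>
  have "1 - q dvd (\<Sum>i<n. 1 - q ^ i)"
    by (intro dvd_sum one_minus_dvd_one_minus_power)
  also have "\<dots> = of_nat n - qnumber q n"
    by (simp add: qnumber_def sum_subtractf)
  finally have "(1 - q) * d dvd (of_nat n - qnumber q n) * d"
    by (rule mult_dvd_mono) simp
  with dvd have "qnumber q n dvd (of_nat n - qnumber q n) * d"
    by (rule dvd_trans)
  then have "qnumber q n dvd (of_nat n - qnumber q n) * d + qnumber q n * d"
    by (rule dvd_add) simp
  then have "qnumber q n dvd smult (of_nat n) d"
    by (simp add: algebra_simps of_nat_poly)
  with assms(1) show ?thesis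
    by (simp add: dvd_smult_iff)
qed

text \<open>If \<open>l\<close> inverts \<open>k\<close> modulo \<open>p\<close>, then
  \<open>1 - q ^ k\<close> divides \<open>1 - q ^ (k * l)\<close>, which is congruent to
  \<open>1 - q\<close> because \<open>q ^ p\<close> is congruent to 1. This reduces the claim to
  cancelling \<open>1 - q\<close>, without irreducibility of \<open>qnumber q p\<close>.\<close>

lemma qnumber_dvd_cancel_one_minus_power:
  fixes q d :: "rat poly"
  assumes "coprime k p" and "p > 1" and dvd: "qnumber q p dvd (1 - q ^ k) * d"
  shows "qnumber q p dvd d"
proof -
  obtain l where "[k * l = 1] (mod p)"
    using cong_solve_coprime_nat[OF assms(1)] by auto
  \<comment> \<open>Needed for a natural number \<open>r\<close> with
    \<open>k * l = 1 + p * r\<close>.\<close>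
  moreover have "k * l \<ge> 1"
    using calculation \<open>p > 1\<close> by (cases "k * l") (auto simp: cong_def)
  ultimately obtain r where r: "k * l = 1 + p * r"
    by (metis cong_le_nat mult.commute add.commute)
  have "(1 - q ^ k) * d dvd (1 - q ^ (k * l)) * d"
    by (simp add: power_mult mult_dvd_mono one_minus_dvd_one_minus_power)
  with dvd have "qnumber q p dvd (1 - q ^ (k * l)) * d"
    by (rule dvd_trans)
  moreover have "qnumber q p dvd (1 - q ^ (p * r)) * (q * d)"
    by (intro dvd_mult2 qnumber_dvd_one_minus_power)
  ultimately have "qnumber q p dvd (1 - q ^ (k * l)) * d - (1 - q ^ (p * r)) * (q * d)"
    by (rule dvd_diff)
  also have "\<dots> = (1 - q) * d"
    by (simp add: r algebra_simps)
  finally show ?thesis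
    by (rule qnumber_dvd_cancel_one_minus[rotated]) (use \<open>p > 1\<close> in simp)
qed

lemma rothe_coeff_cong_1:
  fixes q :: "rat poly"
  assumes "prime p" and "k < p"
  shows "qnumber q p dvd rothe_coeff q (p - 1) k - 1"
  using assms(2)
proof (induction k)
  case 0
  then show ?case by simp
next
  case (Suc k)
  let ?a = "rothe_coeff q (p - 1)"
  have p: "p > 1" using assms(1) by (rule prime_gt_1_nat)
  have "coprime (Suc k) p"
    using Suc.prems assms(1)
    by (metis coprime_commute dvd_imp_le not_le prime_imp_coprime zero_less_Suc)
  moreover have "(1 - q ^ Suc k) * (?a (Suc k) - ?a k) = - ((1 - q ^ (p * 1)) * ?a k)"
    using rothe_coeff_recurrence[of q k "p - 1"] p by (simp add: algebra_simps)
  then have "qnumber q p dvd (1 - q ^ Suc k) * (?a (Suc k) - ?a k)"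
    using qnumber_dvd_one_minus_power[of q p 1] by (metis dvd_minus_iff dvd_mult2)
  ultimately have "qnumber q p dvd ?a (Suc k) - ?a k"
    using p qnumber_dvd_cancel_one_minus_power by blast
  from dvd_add[OF this Suc.IH] Suc.prems show ?case by simp
qed

section \<open>Expansion in t, reflection, and the coefficient sum\<close>

lemma one_minus_power_expansion:
  fixes t :: "'a::comm_ring_1"
  shows "t ^ 3 dvd (1 - t) ^ n - (1 - of_nat n * t + of_nat (n choose 2) * t ^ 2)"
proof (induction n)
  case 0
  then show ?case by (simp add: numeral_2_eq_2)
next
  case (Suc n)
  \<comment> \<open>Multiplying the quadratic truncation by \<open>1 - t\<close> yields the next
    truncation, by Pascal's rule, and one cubic term.\<close>
  have "(1 - t) ^ Suc n - (1 - of_nat (Suc n) * t + of_nat (Suc n choose 2) * t ^ 2)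
     = (1 - t) * ((1 - t) ^ n - (1 - of_nat n * t + of_nat (n choose 2) * t ^ 2))
       - of_nat (n choose 2) * t ^ 3"
    by (simp add: numeral_2_eq_2 numeral_3_eq_3 algebra_simps)
  then show ?case using Suc.IH by auto
qed

text \<open>Write p = 2h + 1. Then q^p - q^j = -q^j (1 - q^(p-j)); the 2h signs cancel, the
  exponents j add up to ph, and j \<mapsto> p - j permutes the factors.\<close>

lemma prod_power_diff:
  fixes q :: "'a::comm_ring_1"
  shows "(\<Prod>i<2 * h. q ^ (2 * h + 1) - q ^ Suc i)
       = q ^ ((2 * h + 1) * h) * (\<Prod>i<2 * h. 1 - q ^ Suc i)"
proof -
  have "(\<Prod>i<2 * h. q ^ (2 * h + 1) - q ^ Suc i)
      = (\<Prod>i<2 * h. q ^ Suc i * (- (1 - q ^ Suc (2 * h - Suc i))))"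
  proof (intro prod.cong refl)
    fix i assume "i \<in> {..<2 * h}"
    then have "2 * h + 1 = Suc i + Suc (2 * h - Suc i)" by simp
    then have "q ^ (2 * h + 1) = q ^ Suc i * q ^ Suc (2 * h - Suc i)"
      by (metis power_add)
    then show "q ^ (2 * h + 1) - q ^ Suc i = q ^ Suc i * (- (1 - q ^ Suc (2 * h - Suc i)))"
      by (simp only: right_diff_distrib mult_minus_right mult_1_right minus_diff_eq)
  qed
  also have "\<dots> = (\<Prod>i<2 * h. q ^ Suc i) * (\<Prod>i<2 * h. - (1 - q ^ Suc (2 * h - Suc i)))"
    by (rule prod.distrib)
  also have "(\<Prod>i<2 * h. - (1 - q ^ Suc (2 * h - Suc i))) = (\<Prod>i<2 * h. - (1 - q ^ Suc i))"
    by (rule prod.nat_diff_reindex)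
  also have "\<dots> = (\<Prod>i<2 * h. 1 - q ^ Suc i)"
    by (simp only: prod_uminus) simp
  also have "(\<Prod>i<2 * h. q ^ Suc i) = q ^ (\<Sum>i<2 * h. Suc i)"
    by (rule power_sum[symmetric])
  also have "(\<Sum>i<2 * h. Suc i) = (2 * h + 1) * h"
    by (induction h) simp_all
  finally show ?thesis .
qed

lemma of_nat_choose_two: "of_nat (n choose 2) = (of_nat n * (of_nat n - 1) / 2 :: 'a::field_char_0)"
  by (induction n) (simp_all add: numeral_2_eq_2 field_simps)

lemma sum_of_nat_choose_two:
  fixes h m :: nat
  shows "(\<Sum>k\<le>2 * h. of_nat (m * k choose 2) - of_nat (m * h choose 2)
      + of_nat m * (of_nat (2 * h - k choose 2) - of_nat (h choose 2)))
    = (of_nat m * (of_nat m + 1) * (of_nat (2 * h + 1) ^ 2 - 1) * of_nat (2 * h + 1) / 24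
       :: 'a::field_char_0)"
proof -
  let ?m = "of_nat m :: 'a" and ?h = "of_nat h :: 'a"
  have squares: "(\<Sum>k\<le>n. of_nat k ^ 2) = (of_nat n * (of_nat n + 1) * (2 * of_nat n + 1) / 6 :: 'a)"
    for n by (induction n) (simp_all add: field_simps power2_eq_square)
  have "(\<Sum>k\<le>2 * h. of_nat (m * k choose 2) - of_nat (m * h choose 2)
      + ?m * (of_nat (2 * h - k choose 2) - of_nat (h choose 2)))
    = (\<Sum>k\<le>2 * h. ?m * (?m + 1) / 2 * (of_nat k ^ 2 - ?h ^ 2) - 2 * ?m * ?h * (of_nat k - ?h))"
    by (intro sum.cong refl)
       (simp add: of_nat_choose_two of_nat_diff field_simps power2_eq_square)
  also have "\<dots> = ?m * (?m + 1) / 2 * ((\<Sum>k\<le>2 * h. of_nat k ^ 2) - (2 * ?h + 1) * ?h ^ 2)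
      - 2 * ?m * ?h * ((\<Sum>k\<le>2 * h. of_nat k) - (2 * ?h + 1) * ?h)"
    by (simp only: sum_subtractf sum_constant flip: sum_distrib_left) (simp add: add.commute)
  also have "(\<Sum>k\<le>2 * h. of_nat k) = (2 * ?h + 1) * ?h"
    by (induction h) (simp_all add: algebra_simps)
  also have "?m * (?m + 1) / 2 * ((\<Sum>k\<le>2 * h. of_nat k ^ 2) - (2 * ?h + 1) * ?h ^ 2)
      - 2 * ?m * ?h * ((2 * ?h + 1) * ?h - (2 * ?h + 1) * ?h)
    = ?m * (?m + 1) * (of_nat (2 * h + 1) ^ 2 - 1) * of_nat (2 * h + 1) / 24"
    unfolding squares by (simp add: field_simps power2_eq_square)
  finally show ?thesis .
qed

section \<open>Assembly modulo the cube\<close>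

theorem theorem2:
  fixes p m :: nat and q :: "rat poly"
  assumes "prime p" and "odd p" and "m \<ge> 1"
  defines "q \<equiv> indet"
  shows "[qpochhammer (q ^ (m * p + 1)) q (p - 1)
            - q ^ (m * p * (p - 1) div 2) * qpochhammer q q (p - 1)
          = smult (of_nat m * (of_nat m + 1) * (of_nat p ^ 2 - 1) * of_nat p / 24)
              ((1 - q) ^ 2 * qnumber q p ^ 2)] (mod qnumber q p ^ 3)"
proof -
  obtain h where p: "p = 2 * h + 1" using \<open>odd p\<close> by (rule oddE)
  define \<Phi> where "\<Phi> = qnumber q p"
  define t where "t = 1 - q ^ p"
  define a where "a = rothe_coeff q (2 * h)"
  \<comment> \<open>\<open>T n\<close> is the truncation of \<open>(1 - t) ^ n\<close> after the
    quadratic term; \<open>c k\<close> will be the only coefficient that survives.\<close>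
  define T where "T n = 1 - of_nat n * t + of_nat (n choose 2) * t ^ 2" for n
  define c :: "nat \<Rightarrow> rat" where
    "c k = of_nat (m * k choose 2) - of_nat (m * h choose 2)
      + of_nat m * (of_nat (2 * h - k choose 2) - of_nat (h choose 2))" for k
  define B where "B = qpochhammer (q ^ (m * p + 1)) q (p - 1)
            - q ^ (m * p * (p - 1) div 2) * qpochhammer q q (p - 1)"
  have t: "t = (1 - q) * \<Phi>"
    by (simp add: t_def \<Phi>_def one_minus_mult_qnumber)
  have q_power: "q ^ (p * n) = (1 - t) ^ n" for n
    by (simp add: t_def power_mult)
  have poch: "qpochhammer (x * q) q (2 * h) = (\<Sum>k\<le>2 * h. a k * x ^ k)" for x
    using prod_eq_sum_rothe_coeff[of 1 x q "2 * h"]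
    by (simp add: qpochhammer_def a_def mult_ac)
  have "B = (\<Sum>k\<le>2 * h. a k * ((1 - t) ^ (m * k) - (1 - t) ^ (m * h)))"
  proof -
    have "q ^ (m * p + 1) = (1 - t) ^ m * q"
      using q_power[of m] by (simp add: mult_ac)
    moreover have "m * p * (p - 1) div 2 = p * (m * h)"
      by (simp add: p algebra_simps)
    ultimately have "B = qpochhammer ((1 - t) ^ m * q) q (2 * h)
        - (1 - t) ^ (m * h) * qpochhammer (1 * q) q (2 * h)"
      unfolding B_def by (simp only: q_power mult_1_left) (simp add: p)
    also have "\<dots> = (\<Sum>k\<le>2 * h. a k * ((1 - t) ^ (m * k) - (1 - t) ^ (m * h)))"
      unfolding poch by (simp add: sum_distrib_left sum_subtractf algebra_simps flip: power_mult)
    finally show ?thesis .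
  qed
  \<comment> \<open>The reflection identity with both products expanded at \<open>x = 1\<close>, for
    \<open>z = 1 - t\<close> and \<open>z = 1\<close>.\<close>
  moreover have "(\<Sum>k\<le>2 * h. a k * (1 - t) ^ (2 * h - k)) = (1 - t) ^ h * (\<Sum>k\<le>2 * h. a k)"
  proof -
    have "(\<Prod>i<2 * h. 1 - t - q ^ Suc i) = (1 - t) ^ h * (\<Prod>i<2 * h. 1 - q ^ Suc i)"
      using prod_power_diff[of q h] q_power[of 1] q_power[of h]
      by (simp only: p mult_1_right power_one_right)
    then show ?thesis
      using prod_eq_sum_rothe_coeff[of "1 - t" 1 q "2 * h"] prod_eq_sum_rothe_coeff[of 1 1 q "2 * h"]
      by (simp add: a_def)
  qed
  then have "(\<Sum>k\<le>2 * h. a k * ((1 - t) ^ (2 * h - k) - (1 - t) ^ h)) = 0"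
    by (simp add: sum_distrib_left sum_subtractf algebra_simps)
  ultimately have "B = (\<Sum>k\<le>2 * h. a k * ((1 - t) ^ (m * k) - (1 - t) ^ (m * h)))
      + of_nat m * (\<Sum>k\<le>2 * h. a k * ((1 - t) ^ (2 * h - k) - (1 - t) ^ h))"
    by simp
  then have B: "B = (\<Sum>k\<le>2 * h. a k * ((1 - t) ^ (m * k) - (1 - t) ^ (m * h)
        + of_nat m * ((1 - t) ^ (2 * h - k) - (1 - t) ^ h)))"
    by (simp add: sum_distrib_left sum.distrib[symmetric] algebra_simps)
  \<comment> \<open>The constants cancel, and so do the linear terms: mk - mh + m((2h - k) - h) =
    0.\<close>
  have Tc: "T (m * k) - T (m * h) + of_nat m * (T (2 * h - k) - T h) = [:c k:] * t ^ 2"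
    if "k \<le> 2 * h" for k
  proof -
    have ck: "[:c k:] = of_nat (m * k choose 2) - of_nat (m * h choose 2)
      + of_nat m * (of_nat (2 * h - k choose 2) - of_nat (h choose 2))"
      by (simp add: c_def of_nat_poly)
    show ?thesis
      unfolding ck using that by (simp add: T_def of_nat_diff algebra_simps)
  qed
  have "\<Phi> ^ 3 dvd a k * ((1 - t) ^ (m * k) - (1 - t) ^ (m * h)
        + of_nat m * ((1 - t) ^ (2 * h - k) - (1 - t) ^ h)) - [:c k:] * t ^ 2"
    if "k \<le> 2 * h" for k
  proof -
    have E: "\<Phi> ^ 3 dvd (1 - t) ^ n - T n" for n
    proof -
      have "\<Phi> ^ 3 dvd t ^ 3" by (simp add: t dvd_power_same)
      then show ?thesis
        unfolding T_def using one_minus_power_expansion by (rule dvd_trans)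
    qed
    have "\<Phi> dvd a k - 1"
      using rothe_coeff_cong_1[OF \<open>prime p\<close>, of k q] that by (simp add: a_def \<Phi>_def p)
    \<comment> \<open>One factor comes from \<open>a k - 1\<close> and two from
      \<open>t ^ 2\<close>, so \<open>a k\<close> may be replaced by 1 in front of
      \<open>t ^ 2\<close>.\<close>
    then have "\<Phi> * \<Phi> ^ 2 dvd (a k - 1) * t ^ 2"
      by (intro mult_dvd_mono dvd_power_same) (simp_all add: t)
    then have "\<Phi> ^ 3 dvd (a k - 1) * t ^ 2"
      by (simp add: power3_eq_cube power2_eq_square mult_ac)
    \<comment> \<open>The total error: truncating the four powers, then replacing \<open>a k\<close>
      by 1.\<close>
    then have "\<Phi> ^ 3 dvd a k * (((1 - t) ^ (m * k) - T (m * k)) - ((1 - t) ^ (m * h) - T (m * h))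
        + of_nat m * (((1 - t) ^ (2 * h - k) - T (2 * h - k)) - ((1 - t) ^ h - T h)))
        + [:c k:] * ((a k - 1) * t ^ 2)"
      by (rule dvd_add[OF dvd_mult[OF dvd_add[OF dvd_diff[OF E E] dvd_mult[OF dvd_diff[OF E E]]]] dvd_mult])
    also have "\<dots> = a k * ((1 - t) ^ (m * k) - (1 - t) ^ (m * h)
        + of_nat m * ((1 - t) ^ (2 * h - k) - (1 - t) ^ h))
        - a k * (T (m * k) - T (m * h) + of_nat m * (T (2 * h - k) - T h))
        + a k * ([:c k:] * t ^ 2) - [:c k:] * t ^ 2"
      by (simp only: algebra_simps)
    finally show ?thesis
      unfolding Tc[OF that] by (simp only: diff_add_cancel)
  qed
  then have "\<Phi> ^ 3 dvd B - (\<Sum>k\<le>2 * h. [:c k:] * t ^ 2)"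
    unfolding B sum_subtractf[symmetric] by (intro dvd_sum) simp
  also have "(\<Sum>k\<le>2 * h. [:c k:] * t ^ 2) = smult (\<Sum>k\<le>2 * h. c k) (t ^ 2)"
    by (simp add: smult_sum)
  also have "(\<Sum>k\<le>2 * h. c k) = of_nat m * (of_nat m + 1) * (of_nat p ^ 2 - 1) * of_nat p / 24"
    unfolding c_def p by (rule sum_of_nat_choose_two)
  finally show ?thesis
    by (simp add: cong_rat_poly_iff B_def t \<Phi>_def power_mult_distrib)
qed

end
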